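(* Let $(X,\leq)$ be a poset, $C$ a closure operator on $X$, and $(L,\leq)$ a complete lattice. For each up-set $T$ of the poset $X/C$ let $S_T=\bigcup_{[x]\in T}[x]\subseteq X$, and let $\mathcal{S}=\{S_T\mid T\in\mathcal{F}_{X/C}\}$. Suppose there exists a closure operator $C_1$ on $L$ such that $L/C_1$ is order isomorphic to $F_X=(\mathcal{F}_X,\supseteq)$. Then $(\mathcal{F}^u_L(X/C)/\sim,\leq)\cong[0,[\mu]_\sim]$, where $0$ is the bottom element of the lattice $(\mathcal{F}^u_L(X)/\sim,\leq)$ and $\mu\in\mathcal{F}^u_L(X)$ satisfies $\mu_L=\mathcal{S}$.
   Context: A closure operator on a poset $P$ is a map $C:P\to P$ with $p\leq C(p)$, $p\leq q\Rightarrow C(p)\leq C(q)$, $C(C(p))=C(p)$; $P/C$ is the set of equivalence classes $[x]$ of $x\sim' y\iff C(x)=C(y)$, ordered by $[x]\leq[y]$ iff $C(x)\leq C(y)$. For a poset $Y$, an up-set is a subset $U$ with $x\in U$, $x\leq y\Rightarrow y\in U$; $\mathcal{F}_Y$ is the set of all up-sets of $Y$ and $F_Y=(\mathcal{F}_Y,\supseteq)$. An $L$-fuzzy up-set on a poset $Y$ is a map $\mu:Y\to L$ with $x\leq y\Rightarrow\mu(x)\leq\mu(y)$; $\mathcal{F}^u_L(Y)$ is the set of all of them. For $p\in L$, $\mu_p=\{y\in Y\mid\mu(y)\geq p\}$ and $\mu_L=\{\mu_p\mid p\in L\}$. On $\mathcal{F}^u_L(Y)$, $\mu\sim\nu$ iff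 $\mu_L=\nu_L$, and $[\mu]_\sim\leq[\nu]_\sim$ iff $\mu_L\subseteq\nu_L$. $[0,[\mu]_\sim]$ denotes the interval $\{a\in\mathcal{F}^u_L(X)/\sim \mid 0\leq a\leq[\mu]_\sim\}$.
   Formalization: The ordered set of classes of L-fuzzy up-sets on X is treated only as a poset with a bottom element 0, not as a lattice, since it can fail to be one (e.g. X a 4-element antichain, L = 2^4, C_1 the identity). *)

theory Defs
  imports "HOL-Algebra.Complete_Lattice" "HOL-Library.FuncSet"
begin

definition closure_operator :: "('a, 'm) gorder_scheme \<Rightarrow> ('a \<Rightarrow> 'a) \<Rightarrow> bool" where
  "closure_operator P C \<longleftrightarrow>
     C \<in> carrier P \<rightarrow> carrier P \<and>
     (\<forall>p\<in>carrier P. p \<sqsubseteq>\<^bsub>P\<^esub> C p) \<and> Mono\<^bsub>P\<^esub> C \<and> Idem\<^bsub>P\<^esub> C"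

definition closure_rel :: "('a, 'm) gorder_scheme \<Rightarrow> ('a \<Rightarrow> 'a) \<Rightarrow> ('a \<times> 'a) set" where
  "closure_rel P C = {(x, y). x \<in> carrier P \<and> y \<in> carrier P \<and> C x = C y}"

text \<open>The order does not depend on the chosen representatives, see
  \<open>closure_quotient_le_iff\<close> below.\<close>

definition closure_quotient :: "('a, 'm) gorder_scheme \<Rightarrow> ('a \<Rightarrow> 'a) \<Rightarrow> 'a set gorder" where
  "closure_quotient P C =
     \<lparr> carrier = carrier P // closure_rel P C,
       eq = (=),
       le = (\<lambda>A B. \<exists>x\<in>A. \<exists>y\<in>B. C x \<sqsubseteq>\<^bsub>P\<^esub> C y) \<rparr>"

definition up_sets :: "('a, 'm) gorder_scheme \<Rightarrow> 'a set set" where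
  "up_sets Y =
     {U. U \<subseteq> carrier Y \<and> (\<forall>x\<in>U. \<forall>y\<in>carrier Y. x \<sqsubseteq>\<^bsub>Y\<^esub> y \<longrightarrow> y \<in> U)}"

definition up_set_order :: "('a, 'm) gorder_scheme \<Rightarrow> 'a set gorder" where
  "up_set_order Y = \<lparr> carrier = up_sets Y, eq = (=), le = (\<supseteq>) \<rparr>"

definition order_isomorphic :: "('a, 'm) gorder_scheme \<Rightarrow> ('b, 'n) gorder_scheme \<Rightarrow> bool" where
  "order_isomorphic P Q \<longleftrightarrow> (\<exists>f. bij_betw f (carrier P) (carrier Q) \<and> order_emb P Q f)"

definition fuzzy_up_sets ::
  "('l, 'm) gorder_scheme \<Rightarrow> ('a, 'n) gorder_scheme \<Rightarrow> ('a \<Rightarrow> 'l) set" where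
  "fuzzy_up_sets L Y = {\<mu> \<in> carrier Y \<rightarrow>\<^sub>E carrier L. isotone Y L \<mu>}"

definition cut ::
  "('l, 'm) gorder_scheme \<Rightarrow> ('a, 'n) gorder_scheme \<Rightarrow> ('a \<Rightarrow> 'l) \<Rightarrow> 'l \<Rightarrow> 'a set" where
  "cut L Y \<mu> p = {y \<in> carrier Y. p \<sqsubseteq>\<^bsub>L\<^esub> \<mu> y}"

definition cuts ::
  "('l, 'm) gorder_scheme \<Rightarrow> ('a, 'n) gorder_scheme \<Rightarrow> ('a \<Rightarrow> 'l) \<Rightarrow> 'a set set" where
  "cuts L Y \<mu> = cut L Y \<mu> ` carrier L"

definition fuzzy_rel ::
  "('l, 'm) gorder_scheme \<Rightarrow> ('a, 'n) gorder_scheme \<Rightarrow> (('a \<Rightarrow> 'l) \<times> ('a \<Rightarrow> 'l)) set" where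
  "fuzzy_rel L Y =
     {(\<mu>, \<nu>). \<mu> \<in> fuzzy_up_sets L Y \<and> \<nu> \<in> fuzzy_up_sets L Y \<and> cuts L Y \<mu> = cuts L Y \<nu>}"

abbreviation fuzzy_class ::
  "('l, 'm) gorder_scheme \<Rightarrow> ('a, 'n) gorder_scheme \<Rightarrow> ('a \<Rightarrow> 'l) \<Rightarrow> ('a \<Rightarrow> 'l) set" where
  "fuzzy_class L Y \<mu> \<equiv> fuzzy_rel L Y `` {\<mu>}"

definition fuzzy_quotient ::
  "('l, 'm) gorder_scheme \<Rightarrow> ('a, 'n) gorder_scheme \<Rightarrow> ('a \<Rightarrow> 'l) set gorder" where
  "fuzzy_quotient L Y =
     \<lparr> carrier = fuzzy_up_sets L Y // fuzzy_rel L Y,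
       eq = (=),
       le = (\<lambda>A B. \<exists>\<mu>\<in>A. \<exists>\<nu>\<in>B. cuts L Y \<mu> \<subseteq> cuts L Y \<nu>) \<rparr>"

definition interval_order :: "'a gorder \<Rightarrow> 'a \<Rightarrow> 'a \<Rightarrow> 'a gorder" where
  "interval_order P a b = P\<lparr> carrier := \<lbrace>a..b\<rbrace>\<^bsub>P\<^esub> \<rparr>"

text \<open>Elements of the quotient are the classes themselves, so the union of all classes
  belonging to \<open>T\<close> is \<open>\<Union>T\<close>.\<close>

definition saturated_up_sets :: "('a, 'm) gorder_scheme \<Rightarrow> ('a \<Rightarrow> 'a) \<Rightarrow> 'a set set" where
  "saturated_up_sets X C = {\<Union>T | T. T \<in> up_sets (closure_quotient X C)}"

lemma closure_quotient_le_iff: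
  assumes "x \<in> carrier P" "y \<in> carrier P"
  shows "closure_rel P C `` {x} \<sqsubseteq>\<^bsub>closure_quotient P C\<^esub> closure_rel P C `` {y}
           \<longleftrightarrow> C x \<sqsubseteq>\<^bsub>P\<^esub> C y"
  using assms by (force simp: closure_quotient_def closure_rel_def)

lemma fuzzy_quotient_le_iff:
  assumes "\<mu> \<in> fuzzy_up_sets L Y" "\<nu> \<in> fuzzy_up_sets L Y"
  shows "fuzzy_class L Y \<mu> \<sqsubseteq>\<^bsub>fuzzy_quotient L Y\<^esub> fuzzy_class L Y \<nu>
           \<longleftrightarrow> cuts L Y \<mu> \<subseteq> cuts L Y \<nu>"
  using assms by (force simp: fuzzy_quotient_def fuzzy_rel_def)

lemma partial_order_closure_quotient:
  assumes "partial_order P" and "closure_operator P C"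
  shows "partial_order (closure_quotient P C)"
proof -
  interpret P: partial_order P by fact
  have C: "C x \<in> carrier P" if "x \<in> carrier P" for x
    using assms(2) that by (auto simp: closure_operator_def)
  have le: "a \<sqsubseteq>\<^bsub>closure_quotient P C\<^esub> b \<longleftrightarrow> C x \<sqsubseteq>\<^bsub>P\<^esub> C y"
    if "a = closure_rel P C `` {x}" "b = closure_rel P C `` {y}" "x \<in> carrier P" "y \<in> carrier P"
    for a b x y
    using closure_quotient_le_iff[of x P y C] that by simp
  have ex: "\<exists>x\<in>carrier P. a = closure_rel P C `` {x}" if "a \<in> carrier (closure_quotient P C)" for a
    using that by (auto simp: closure_quotient_def quotient_def)
  have eq: "eq (closure_quotient P C) = (=)" by (simp add: closure_quotient_def)
  show ?thesis
  proof (unfold_locales, unfold eq)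
    fix a assume "a \<in> carrier (closure_quotient P C)"
    then show "a \<sqsubseteq>\<^bsub>closure_quotient P C\<^esub> a" using ex[of a] le C by auto
  next
    fix a b
    assume "a \<sqsubseteq>\<^bsub>closure_quotient P C\<^esub> b" "b \<sqsubseteq>\<^bsub>closure_quotient P C\<^esub> a"
      "a \<in> carrier (closure_quotient P C)" "b \<in> carrier (closure_quotient P C)"
    then obtain x y where xy: "x \<in> carrier P" "y \<in> carrier P"
        "a = closure_rel P C `` {x}" "b = closure_rel P C `` {y}"
        "C x \<sqsubseteq>\<^bsub>P\<^esub> C y" "C y \<sqsubseteq>\<^bsub>P\<^esub> C x"
      using ex le by metis
    then have "C x = C y" using C by (intro P.le_antisym) auto
    then show "a = b" using xy by (auto simp: closure_rel_def)
  next
    fix a b c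
    assume "a \<sqsubseteq>\<^bsub>closure_quotient P C\<^esub> b" "b \<sqsubseteq>\<^bsub>closure_quotient P C\<^esub> c"
      "a \<in> carrier (closure_quotient P C)" "b \<in> carrier (closure_quotient P C)"
      "c \<in> carrier (closure_quotient P C)"
    then show "a \<sqsubseteq>\<^bsub>closure_quotient P C\<^esub> c"
      using ex le C P.le_trans by (smt (verit))
  qed auto
qed

end

theory Submission
  imports Defs
begin

text \<open>
  A fuzzy up-set on \<open>X/C\<close> pulls back along the projection \<open>X \<rightarrow> X/C\<close>, and on cuts this is the
  injection \<open>T \<mapsto> \<Union>T\<close>.  Conversely, if all cuts of \<open>\<rho>\<close> on \<open>X\<close> are unions of classes, then
  equivalent points belong to the same cuts, so \<open>\<rho>\<close> is constant on classes and descends to \<open>X/C\<close>.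
  This gives the isomorphism with the interval below \<open>[\<mu>]\<close>.  For the existence of \<open>\<mu>\<close>, a closure
  operator on \<open>L\<close> with quotient \<open>F\<^sub>X\<close> yields a map \<open>g\<close> from up-sets to closed elements of \<open>L\<close> and a
  surjection \<open>h\<close> from \<open>L\<close> to up-sets such that \<open>p \<le> g U\<close> iff \<open>U \<subseteq> h p\<close>.  Taking \<open>\<mu> x = g (N x)\<close>
  with \<open>N x = {y. x \<le> C y}\<close>, the least saturated up-set containing \<open>x\<close>, the cuts of \<open>\<mu>\<close> are the
  sets \<open>{x. N x \<subseteq> U}\<close> for up-sets \<open>U\<close>, and these are exactly the saturated up-sets.
\<close>

section \<open>Closure operators, their classes and saturated up-sets\<close>

lemma closure_operatorD:
  assumes "partial_order P" and "closure_operator P C"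
  shows "\<And>x. x \<in> carrier P \<Longrightarrow> C x \<in> carrier P"
    and "\<And>x. x \<in> carrier P \<Longrightarrow> x \<sqsubseteq>\<^bsub>P\<^esub> C x"
    and "\<And>x y. x \<in> carrier P \<Longrightarrow> y \<in> carrier P \<Longrightarrow> x \<sqsubseteq>\<^bsub>P\<^esub> y \<Longrightarrow> C x \<sqsubseteq>\<^bsub>P\<^esub> C y"
    and "\<And>x. x \<in> carrier P \<Longrightarrow> C (C x) = C x"
proof -
  interpret P: partial_order P by fact
  show "\<And>x. x \<in> carrier P \<Longrightarrow> C x \<in> carrier P"
    and "\<And>x. x \<in> carrier P \<Longrightarrow> x \<sqsubseteq>\<^bsub>P\<^esub> C x"
    and "\<And>x y. x \<in> carrier P \<Longrightarrow> y \<in> carrier P \<Longrightarrow> x \<sqsubseteq>\<^bsub>P\<^esub> y \<Longrightarrow> C x \<sqsubseteq>\<^bsub>P\<^esub> C y"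
    and "\<And>x. x \<in> carrier P \<Longrightarrow> C (C x) = C x"
    using assms(2) by (auto simp: closure_operator_def isotone_def idempotent_def P.eq_is_equal)
qed

text \<open>Apply \<open>C\<close> and use idempotence in one direction, and
  \<open>x \<sqsubseteq> C x\<close> in the other. This adjunction is used both on \<open>X\<close>
  and on \<open>L\<close> in the construction of \<open>\<mu>\<close>.\<close>

lemma le_closure_iff:
  assumes "partial_order P" and "closure_operator P C" and "x \<in> carrier P" and "y \<in> carrier P"
  shows "x \<sqsubseteq>\<^bsub>P\<^esub> C y \<longleftrightarrow> C x \<sqsubseteq>\<^bsub>P\<^esub> C y"
proof -
  interpret P: partial_order P by fact
  note C = closure_operatorD[OF assms(1,2)]
  show ?thesis
    using C(3)[of x "C y"] C(1,2,4) P.le_trans[of x "C x" "C y"] assms(3,4) by metis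
qed

lemma closure_class_in_quotient:
  "x \<in> carrier P \<Longrightarrow> closure_rel P C `` {x} \<in> carrier (closure_quotient P C)"
  by (auto simp: closure_quotient_def intro: quotientI)

lemma closure_quotientE:
  assumes "a \<in> carrier (closure_quotient P C)"
  obtains x where "x \<in> carrier P" and "a = closure_rel P C `` {x}"
  using assms by (auto simp: closure_quotient_def elim: quotientE)

lemma closure_class_self: "x \<in> carrier P \<Longrightarrow> x \<in> closure_rel P C `` {x}"
  by (simp add: closure_rel_def)

lemma closure_class_eq_iff:
  assumes "x \<in> carrier P" and "y \<in> carrier P"
  shows "closure_rel P C `` {x} = closure_rel P C `` {y} \<longleftrightarrow> C x = C y"
  using assms by (auto simp: closure_rel_def)

lemma closure_class_unique:
  assumes "a \<in> carrier (closure_quotient P C)" and "x \<in> a"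
  shows "x \<in> carrier P" and "a = closure_rel P C `` {x}"
  using assms by (auto elim!: closure_quotientE simp: closure_rel_def)

lemma Union_classes_eq:
  assumes "T \<subseteq> carrier (closure_quotient P C)"
  shows "\<Union>T = {x \<in> carrier P. closure_rel P C `` {x} \<in> T}"
  using assms closure_class_unique[of _ P C] closure_class_self[of _ P C] by blast

text \<open>The classes are nonempty and pairwise disjoint, so a class belongs to a family exactly
  when its representative lies in the union of the family.\<close>

lemma inj_on_Union_classes: "inj_on Union (Pow (carrier (closure_quotient P C)))"
proof (rule inj_onI)
  fix S T assume *: "S \<in> Pow (carrier (closure_quotient P C))"
    "T \<in> Pow (carrier (closure_quotient P C))" "\<Union>S = \<Union>T"
  have "a \<in> S \<longleftrightarrow> a \<in> T" if "a \<in> carrier (closure_quotient P C)" for a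
    using that * Union_classes_eq[of S P C] Union_classes_eq[of T P C]
    by (auto elim!: closure_quotientE)
  with * show "S = T" by auto
qed

text \<open>This describes the unions of classes inside \<open>X\<close>, without the quotient. The
  converse implication, from \<open>x \<in> U\<close> to \<open>C x \<in> U\<close>, is automatic
  for an up-set because \<open>x \<sqsubseteq> C x\<close>; so a single implication expresses
  saturation.\<close>

lemma saturated_up_sets_eq:
  assumes "partial_order X" and "closure_operator X C"
  shows "saturated_up_sets X C = {U \<in> up_sets X. \<forall>x\<in>carrier X. C x \<in> U \<longrightarrow> x \<in> U}"
proof (intro Set.set_eqI iffI)
  note C = closure_operatorD[OF assms]
  fix U assume "U \<in> saturated_up_sets X C"
  then obtain T where T: "T \<in> up_sets (closure_quotient X C)" and U: "U = \<Union>T"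
    by (auto simp: saturated_up_sets_def)
  have "T \<subseteq> carrier (closure_quotient X C)" using T by (auto simp: up_sets_def)
  from U Union_classes_eq[OF this]
  have U: "U = {x \<in> carrier X. closure_rel X C `` {x} \<in> T}" by simp
  have up: "y \<in> U" if "x \<in> U" "y \<in> carrier X" "C x \<sqsubseteq>\<^bsub>X\<^esub> C y" for x y
    using that T closure_quotient_le_iff[of x X y C] closure_class_in_quotient[of y X C]
    by (auto simp: U up_sets_def)
  have sub: "U \<subseteq> carrier X" by (auto simp: U)
  have "U \<in> up_sets X"
    unfolding up_sets_def using sub up C(3) by blast
  moreover have "x \<in> U" if "x \<in> carrier X" "C x \<in> U" for x
    using that C(1,4) closure_class_eq_iff[of "C x" X x C] by (auto simp: U)
  ultimately show "U \<in> {U \<in> up_sets X. \<forall>x\<in>carrier X. C x \<in> U \<longrightarrow> x \<in> U}" by blast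
next
  note C = closure_operatorD[OF assms]
  fix U assume "U \<in> {U \<in> up_sets X. \<forall>x\<in>carrier X. C x \<in> U \<longrightarrow> x \<in> U}"
  then have sub: "U \<subseteq> carrier X" and sat: "\<And>x. x \<in> carrier X \<Longrightarrow> C x \<in> U \<Longrightarrow> x \<in> U"
    and up: "\<And>x y. x \<in> U \<Longrightarrow> y \<in> carrier X \<Longrightarrow> x \<sqsubseteq>\<^bsub>X\<^esub> y \<Longrightarrow> y \<in> U"
    unfolding up_sets_def by blast+
  \<comment> \<open>Climb from \<open>x\<close> to \<open>C x\<close> and on to \<open>C y\<close>
    within the up-set, then return to \<open>y\<close> by saturation. This is what makes
    \<open>T\<close> below an up-set of the quotient.\<close>
  have up': "y \<in> U" if "x \<in> U" "y \<in> carrier X" "C x \<sqsubseteq>\<^bsub>X\<^esub> C y" for x y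
  proof -
    have "C x \<in> U" using that sub C(1,2) up[of x "C x"] by blast
    then have "C y \<in> U" using that C(1) up[of "C x" "C y"] by blast
    then show ?thesis using that sat by blast
  qed
  define T where "T = (\<lambda>x. closure_rel X C `` {x}) ` U"
  have in_T: "closure_rel X C `` {x} \<in> T \<longleftrightarrow> x \<in> U" if "x \<in> carrier X" for x
  proof
    assume "closure_rel X C `` {x} \<in> T"
    then obtain y where y: "y \<in> U" "closure_rel X C `` {x} = closure_rel X C `` {y}"
      by (auto simp: T_def)
    have y': "y \<in> carrier X" using y(1) sub by (rule subsetD[rotated])
    have "C x = C y" using y(2) by (simp add: closure_class_eq_iff that y')
    moreover have "C y \<in> U" using y(1) C(1)[OF y'] C(2)[OF y'] by (rule up)
    ultimately show "x \<in> U" by (intro sat[OF that]) simp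
  next
    assume "x \<in> U"
    then show "closure_rel X C `` {x} \<in> T" unfolding T_def by (rule imageI)
  qed
  have T_sub: "T \<subseteq> carrier (closure_quotient X C)"
    using sub closure_class_in_quotient[of _ X C] by (auto simp: T_def)
  have "T \<in> up_sets (closure_quotient X C)"
    unfolding up_sets_def
  proof (intro CollectI conjI ballI impI T_sub)
    fix a b assume "a \<in> T" "b \<in> carrier (closure_quotient X C)"
      "a \<sqsubseteq>\<^bsub>closure_quotient X C\<^esub> b"
    moreover from this obtain x y where xy: "x \<in> U" "a = closure_rel X C `` {x}"
      "y \<in> carrier X" "b = closure_rel X C `` {y}"
      unfolding T_def by (blast elim: closure_quotientE)
    ultimately have "C x \<sqsubseteq>\<^bsub>X\<^esub> C y"
      using sub closure_quotient_le_iff[of x X y C] by blast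
    with xy show "b \<in> T" using up' in_T by blast
  qed
  moreover have "\<Union>T = U" using Union_classes_eq[OF T_sub] in_T sub by auto
  ultimately show "U \<in> saturated_up_sets X C" by (auto simp: saturated_up_sets_def)
qed

section \<open>Fuzzy up-sets ordered by their families of cuts\<close>

lemma fuzzy_classE:
  assumes "A \<in> carrier (fuzzy_quotient L Y)"
  obtains \<mu> where "\<mu> \<in> fuzzy_up_sets L Y" and "A = fuzzy_class L Y \<mu>"
  using assms by (auto simp: fuzzy_quotient_def elim: quotientE)

lemma fuzzy_class_in_quotient:
  "\<mu> \<in> fuzzy_up_sets L Y \<Longrightarrow> fuzzy_class L Y \<mu> \<in> carrier (fuzzy_quotient L Y)"
  by (auto simp: fuzzy_quotient_def intro: quotientI)

lemma fuzzy_class_eq_iff: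
  assumes "\<mu> \<in> fuzzy_up_sets L Y" and "\<nu> \<in> fuzzy_up_sets L Y"
  shows "fuzzy_class L Y \<mu> = fuzzy_class L Y \<nu> \<longleftrightarrow> cuts L Y \<mu> = cuts L Y \<nu>"
  using assms by (auto simp: fuzzy_rel_def)

lemma partial_order_fuzzy_quotient: "partial_order (fuzzy_quotient L Y)"
proof -
  have eq: "eq (fuzzy_quotient L Y) = (=)" by (simp add: fuzzy_quotient_def)
  show ?thesis
  proof (unfold_locales, unfold eq)
    fix a assume "a \<in> carrier (fuzzy_quotient L Y)"
    then show "a \<sqsubseteq>\<^bsub>fuzzy_quotient L Y\<^esub> a"
      by (elim fuzzy_classE) (simp add: fuzzy_quotient_le_iff)
  next
    fix a b assume "a \<sqsubseteq>\<^bsub>fuzzy_quotient L Y\<^esub> b" "b \<sqsubseteq>\<^bsub>fuzzy_quotient L Y\<^esub> a"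
      "a \<in> carrier (fuzzy_quotient L Y)" "b \<in> carrier (fuzzy_quotient L Y)"
    then show "a = b"
      by (elim fuzzy_classE) (simp add: fuzzy_quotient_le_iff fuzzy_class_eq_iff)
  next
    fix a b c assume "a \<sqsubseteq>\<^bsub>fuzzy_quotient L Y\<^esub> b" "b \<sqsubseteq>\<^bsub>fuzzy_quotient L Y\<^esub> c"
      "a \<in> carrier (fuzzy_quotient L Y)" "b \<in> carrier (fuzzy_quotient L Y)"
      "c \<in> carrier (fuzzy_quotient L Y)"
    then show "a \<sqsubseteq>\<^bsub>fuzzy_quotient L Y\<^esub> c"
      by (elim fuzzy_classE) (simp add: fuzzy_quotient_le_iff)
  qed auto
qed

text \<open>The constant map to the top of \<open>L\<close> has no cut other than the whole carrier,
  and the whole carrier is the cut of every fuzzy up-set at the bottom of \<open>L\<close>. Since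
  the bottom is defined by choice, exhibiting one least element suffices.\<close>

lemma bottom_fuzzy_quotient_least:
  assumes "partial_order Y" and "complete_lattice L"
  shows "least (fuzzy_quotient L Y) \<bottom>\<^bsub>fuzzy_quotient L Y\<^esub> (carrier (fuzzy_quotient L Y))"
proof -
  interpret Y: partial_order Y by fact
  interpret L: complete_lattice L by fact
  define \<tau> where "\<tau> = (\<lambda>y\<in>carrier Y. \<top>\<^bsub>L\<^esub>)"
  have \<tau>: "\<tau> \<in> fuzzy_up_sets L Y"
    by (auto simp: \<tau>_def fuzzy_up_sets_def isotone_def
        Y.weak_partial_order_axioms L.weak_partial_order_axioms)
  have cuts: "cuts L Y \<tau> \<subseteq> {carrier Y}"
    by (auto simp: cuts_def cut_def \<tau>_def)
  have "carrier Y \<in> cuts L Y \<nu>" if "\<nu> \<in> fuzzy_up_sets L Y" for \<nu>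
  proof -
    have "cut L Y \<nu> \<bottom>\<^bsub>L\<^esub> = carrier Y" using that by (auto simp: cut_def fuzzy_up_sets_def)
    then show ?thesis by (auto simp: cuts_def)
  qed
  then have "cuts L Y \<tau> \<subseteq> cuts L Y \<nu>" if "\<nu> \<in> fuzzy_up_sets L Y" for \<nu>
    using cuts that by blast
  then have "least (fuzzy_quotient L Y) (fuzzy_class L Y \<tau>) (carrier (fuzzy_quotient L Y))"
    using \<tau>
    by (auto simp only: least_def fuzzy_class_in_quotient fuzzy_quotient_le_iff subset_refl
        elim!: fuzzy_classE)
  then show ?thesis unfolding bottom_def by (rule someI)
qed

section \<open>Existence of a fuzzy up-set whose cuts are the saturated up-sets\<close>

lemma fuzzy_up_set_with_saturated_cuts:
  assumes X: "partial_order X" and CX: "closure_operator X C" and "complete_lattice L"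
    and CL: "closure_operator L D"
    and iso: "order_isomorphic (closure_quotient L D) (up_set_order X)"
  shows "\<exists>\<mu>\<in>fuzzy_up_sets L X. cuts L X \<mu> = saturated_up_sets X C"
proof -
  interpret X: partial_order X by fact
  interpret L: complete_lattice L by fact
  have L: "partial_order L" ..
  note C = closure_operatorD[OF X CX]
  note D = closure_operatorD[OF L CL]
  from iso obtain f where bij: "bij_betw f (carrier (closure_quotient L D)) (up_sets X)"
    and emb: "order_emb (closure_quotient L D) (up_set_order X) f"
    by (auto simp: order_isomorphic_def up_set_order_def)
  define h where "h p = f (closure_rel L D `` {p})" for p
  \<comment> \<open>The inclusion is reversed because up-sets are ordered by
    \<open>\<supseteq>\<close>.\<close>
  have h_le: "D p \<sqsubseteq>\<^bsub>L\<^esub> D q \<longleftrightarrow> h q \<subseteq> h p" if "p \<in> carrier L" "q \<in> carrier L" for p q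
    using emb that closure_class_in_quotient[of _ L D] closure_quotient_le_iff[of p L q D]
    by (auto simp: order_emb_def h_def up_set_order_def)
  have h_image: "h ` carrier L = up_sets X"
  proof -
    have "(\<lambda>p. closure_rel L D `` {p}) ` carrier L = carrier (closure_quotient L D)"
      by (auto simp: closure_quotient_def quotient_def)
    then show ?thesis using bij unfolding bij_betw_def h_def by (metis image_image)
  qed
  \<comment> \<open>The closed element in the class that corresponds to \<open>U\<close>: applying
    \<open>D\<close> makes the choice of a preimage under \<open>h\<close> irrelevant.\<close>
  define g where "g U = D (inv_into (carrier L) h U)" for U
  have g: "g U \<in> carrier L" "\<And>p. p \<in> carrier L \<Longrightarrow> p \<sqsubseteq>\<^bsub>L\<^esub> g U \<longleftrightarrow> U \<subseteq> h p"
    if "U \<in> up_sets X" for U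
  proof -
    have U: "U \<in> h ` carrier L" using h_image that by simp
    note inv = inv_into_into[OF U] f_inv_into_f[OF U]
    show "g U \<in> carrier L" using inv D(1) by (simp add: g_def)
    show "p \<sqsubseteq>\<^bsub>L\<^esub> g U \<longleftrightarrow> U \<subseteq> h p" if "p \<in> carrier L" for p
      using that inv h_le le_closure_iff[OF L CL] by (simp add: g_def)
  qed
  define N where "N x = {y \<in> carrier X. x \<sqsubseteq>\<^bsub>X\<^esub> C y}" for x
  have N_up: "N x \<in> up_sets X" if "x \<in> carrier X" for x
    using that C(1,3) X.le_trans[of x] by (auto simp: N_def up_sets_def)
  have N_anti: "N y \<subseteq> N x" if "x \<in> carrier X" "y \<in> carrier X" "x \<sqsubseteq>\<^bsub>X\<^esub> y" for x y
    using that C(1) X.le_trans[of x y] by (auto simp: N_def)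
  have N_closure: "N (C x) = N x" if "x \<in> carrier X" for x
    using that le_closure_iff[OF X CX] by (auto simp: N_def)
  define \<mu> where "\<mu> = (\<lambda>x\<in>carrier X. g (N x))"
  have "\<mu> x \<sqsubseteq>\<^bsub>L\<^esub> \<mu> y" if "x \<in> carrier X" "y \<in> carrier X" "x \<sqsubseteq>\<^bsub>X\<^esub> y" for x y
  proof -
    \<comment> \<open>The Galois property of \<open>g\<close> at \<open>p = g (N x)\<close>, by
      reflexivity. With \<open>N\<close> antitone, the same property for \<open>N y\<close> then
      yields the monotonicity of \<open>\<mu>\<close>.\<close>
    have "N x \<subseteq> h (g (N x))" using g[OF N_up] L.le_refl that(1) by blast
    with N_anti[OF that] have "N y \<subseteq> h (g (N x))" by blast
    with that g[OF N_up] show ?thesis by (simp add: \<mu>_def)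
  qed
  then have "\<mu> \<in> fuzzy_up_sets L X"
    using g(1)[OF N_up] X.weak_partial_order_axioms L.weak_partial_order_axioms
    by (auto simp: fuzzy_up_sets_def isotone_def \<mu>_def)
  moreover have "cuts L X \<mu> = saturated_up_sets X C"
  proof -
    define K where "K U = {x \<in> carrier X. N x \<subseteq> U}" for U
    have "cut L X \<mu> p = K (h p)" if "p \<in> carrier L" for p
      using that g(2)[OF N_up] by (auto simp: cut_def \<mu>_def K_def)
    then have "cuts L X \<mu> = K ` up_sets X"
      unfolding cuts_def h_image[symmetric] by (auto simp: image_image)
    \<comment> \<open>\<open>K U\<close> is the largest saturated up-set inside \<open>U\<close>. It
      is an up-set because \<open>N\<close> is antitone, and saturated because
      \<open>N (C x) = N x\<close>; conversely, \<open>K\<close> fixes every saturated up-set, so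
      all of them are attained.\<close>
    also have "\<dots> = saturated_up_sets X C"
    proof (intro Set.set_eqI iffI)
      fix V assume "V \<in> K ` up_sets X"
      then obtain U where "V = K U" by blast
      then show "V \<in> saturated_up_sets X C"
        using N_anti N_closure unfolding saturated_up_sets_eq[OF X CX] up_sets_def K_def by blast
    next
      fix V assume V: "V \<in> saturated_up_sets X C"
      then have sub: "V \<subseteq> carrier X" and up: "V \<in> up_sets X"
        and sat: "\<And>x. x \<in> carrier X \<Longrightarrow> C x \<in> V \<Longrightarrow> x \<in> V"
        unfolding saturated_up_sets_eq[OF X CX] up_sets_def by blast+
      have "K V = V"
      proof
        show "K V \<subseteq> V" using C(2) by (auto simp: K_def N_def)
        show "V \<subseteq> K V"
        proof
          fix x assume x: "x \<in> V"
          have "y \<in> V" if "y \<in> N x" for y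
          proof (rule sat)
            show "y \<in> carrier X" using that by (simp add: N_def)
            show "C y \<in> V" using that x up C(1) by (auto simp: N_def up_sets_def)
          qed
          with x sub show "x \<in> K V" by (auto simp: K_def)
        qed
      qed
      with up show "V \<in> K ` up_sets X" by (metis imageI)
    qed
    finally show ?thesis .
  qed
  ultimately show ?thesis by blast
qed

section \<open>Pulling back along the projection, and the isomorphism with the interval\<close>

definition pullback :: "('a, 'm) gorder_scheme \<Rightarrow> ('a \<Rightarrow> 'a) \<Rightarrow> ('a set \<Rightarrow> 'l) \<Rightarrow> 'a \<Rightarrow> 'l" where
  "pullback X C \<nu> = (\<lambda>x\<in>carrier X. \<nu> (closure_rel X C `` {x}))"

lemma pullback_fuzzy_up_set:
  assumes "partial_order X" and "closure_operator X C"
    and "\<nu> \<in> fuzzy_up_sets L (closure_quotient X C)"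
  shows "pullback X C \<nu> \<in> fuzzy_up_sets L X"
proof -
  interpret X: partial_order X by fact
  note C = closure_operatorD[OF assms(1,2)]
  show ?thesis
    using assms(3) C(3) closure_class_in_quotient[of _ X C] closure_quotient_le_iff[of _ X _ C]
      X.weak_partial_order_axioms
    by (auto simp: pullback_def fuzzy_up_sets_def isotone_def)
qed

text \<open>A point lies in a cut of the pullback exactly when its class lies in the cut of
  \<open>\<nu>\<close> at the same level. Hence the pullback respects equality of cuts and passes to
  classes.\<close>

lemma cuts_pullback: "cuts L X (pullback X C \<nu>) = Union ` cuts L (closure_quotient X C) \<nu>"
proof -
  have "cut L X (pullback X C \<nu>) p = \<Union>(cut L (closure_quotient X C) \<nu> p)" for p
    using Union_classes_eq[of "cut L (closure_quotient X C) \<nu> p" X C]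
      closure_class_in_quotient[of _ X C]
    by (auto simp: cut_def pullback_def)
  then show ?thesis by (simp add: cuts_def image_image)
qed

lemma cuts_subset_up_sets:
  assumes "complete_lattice L" and "\<mu> \<in> fuzzy_up_sets L Y"
  shows "cuts L Y \<mu> \<subseteq> up_sets Y"
proof -
  interpret L: complete_lattice L by fact
  have mem: "\<mu> x \<in> carrier L" if "x \<in> carrier Y" for x
    using assms(2) that by (auto simp: fuzzy_up_sets_def)
  have mono: "\<mu> x \<sqsubseteq>\<^bsub>L\<^esub> \<mu> y" if "x \<in> carrier Y" "y \<in> carrier Y" "x \<sqsubseteq>\<^bsub>Y\<^esub> y" for x y
    using assms(2) that by (auto simp: fuzzy_up_sets_def isotone_def)
  show ?thesis
    using L.le_trans[OF _ mono] mem by (auto simp: cuts_def cut_def up_sets_def)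
qed

lemma pullback_surj:
  assumes X: "partial_order X" and CX: "closure_operator X C" and "complete_lattice L"
    and \<rho>: "\<rho> \<in> fuzzy_up_sets L X" and sat: "cuts L X \<rho> \<subseteq> saturated_up_sets X C"
  obtains \<nu> where "\<nu> \<in> fuzzy_up_sets L (closure_quotient X C)" and "pullback X C \<nu> = \<rho>"
proof -
  interpret X: partial_order X by fact
  interpret L: complete_lattice L by fact
  interpret Q: partial_order "closure_quotient X C"
    using X CX by (rule partial_order_closure_quotient)
  note C = closure_operatorD[OF X CX]
  have mem: "\<rho> x \<in> carrier L" if "x \<in> carrier X" for x
    using \<rho> that by (auto simp: fuzzy_up_sets_def)
  have mono: "\<rho> x \<sqsubseteq>\<^bsub>L\<^esub> \<rho> y" if "x \<in> carrier X" "y \<in> carrier X" "x \<sqsubseteq>\<^bsub>X\<^esub> y" for x y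
    using \<rho> that by (auto simp: fuzzy_up_sets_def isotone_def)
  have \<rho>_C: "\<rho> (C x) = \<rho> x" if x: "x \<in> carrier X" for x
  proof (rule L.le_antisym)
    \<comment> \<open>The cut at level \<open>\<rho> (C x)\<close> contains \<open>C x\<close>;
      being saturated, it also contains \<open>x\<close>, which is the nontrivial
      inequality.\<close>
    have "cut L X \<rho> (\<rho> (C x)) \<in> saturated_up_sets X C"
      using sat mem C(1) x by (auto simp: cuts_def)
    moreover have "C x \<in> cut L X \<rho> (\<rho> (C x))"
      using mem C(1) x L.le_refl by (auto simp: cut_def)
    ultimately have "x \<in> cut L X \<rho> (\<rho> (C x))"
      using x unfolding saturated_up_sets_eq[OF X CX] by blast
    then show "\<rho> (C x) \<sqsubseteq>\<^bsub>L\<^esub> \<rho> x" by (simp add: cut_def)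
    show "\<rho> x \<sqsubseteq>\<^bsub>L\<^esub> \<rho> (C x)" using mono C(1,2) x by simp
  qed (use mem C(1) x in auto)
  \<comment> \<open>The chosen representative does not matter: \<open>C\<close> is constant on a
    class and \<open>\<rho>\<close> is unchanged by \<open>C\<close>.\<close>
  define \<nu> where "\<nu> = (\<lambda>a\<in>carrier (closure_quotient X C). \<rho> (SOME x. x \<in> a))"
  have \<nu>: "\<nu> (closure_rel X C `` {x}) = \<rho> x" if x: "x \<in> carrier X" for x
  proof -
    define y where "y = (SOME y. y \<in> closure_rel X C `` {x})"
    have "y \<in> closure_rel X C `` {x}"
      unfolding y_def using closure_class_self[OF x] by (rule someI)
    then have "y \<in> carrier X" "C y = C x" by (auto simp: closure_rel_def)
    then have "\<rho> y = \<rho> x" using \<rho>_C x by metis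
    then show ?thesis using closure_class_in_quotient[OF x] by (simp add: \<nu>_def y_def)
  qed
  have "\<nu> a \<sqsubseteq>\<^bsub>L\<^esub> \<nu> b" if ab: "a \<in> carrier (closure_quotient X C)"
    "b \<in> carrier (closure_quotient X C)" "a \<sqsubseteq>\<^bsub>closure_quotient X C\<^esub> b" for a b
  proof -
    obtain x y where xy: "x \<in> carrier X" "a = closure_rel X C `` {x}"
      "y \<in> carrier X" "b = closure_rel X C `` {y}"
      using ab by (auto elim!: closure_quotientE)
    then have "C x \<sqsubseteq>\<^bsub>X\<^esub> C y" using ab closure_quotient_le_iff[of x X y C] by simp
    then have "\<rho> (C x) \<sqsubseteq>\<^bsub>L\<^esub> \<rho> (C y)" using mono C(1) xy by simp
    then show ?thesis using \<nu> \<rho>_C xy by simp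
  qed
  moreover have "\<nu> a \<in> carrier L" if "a \<in> carrier (closure_quotient X C)" for a
    using that \<nu> mem by (auto elim!: closure_quotientE)
  ultimately have "\<nu> \<in> fuzzy_up_sets L (closure_quotient X C)"
    using Q.weak_partial_order_axioms L.weak_partial_order_axioms
    by (auto simp: fuzzy_up_sets_def isotone_def) (simp add: \<nu>_def)
  moreover have "pullback X C \<nu> = \<rho>"
    using \<nu> \<rho> by (auto simp: pullback_def fuzzy_up_sets_def fun_eq_iff PiE_def extensional_def)
  ultimately show thesis by (rule that)
qed

text \<open>The isomorphism is induced by \<open>pullback\<close>. Injectivity of
  \<open>Union\<close> on families of classes makes it an order embedding, and
  \<open>pullback_surj\<close> makes it reach everything below the class of
  \<open>\<mu>\<close>.\<close>

lemma fuzzy_quotient_closure_quotient_isomorphic: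
  assumes X: "partial_order X" and CX: "closure_operator X C" and L: "complete_lattice L"
    and \<mu>: "\<mu> \<in> fuzzy_up_sets L X" and cuts_\<mu>: "cuts L X \<mu> = saturated_up_sets X C"
  shows "order_isomorphic (fuzzy_quotient L (closure_quotient X C))
    (interval_order (fuzzy_quotient L X) \<bottom>\<^bsub>fuzzy_quotient L X\<^esub> (fuzzy_class L X \<mu>))"
proof -
  let ?Q = "closure_quotient X C"
  let ?F = "fuzzy_quotient L X"
  let ?I = "interval_order ?F \<bottom>\<^bsub>?F\<^esub> (fuzzy_class L X \<mu>)"
  interpret F: partial_order ?F by (rule partial_order_fuzzy_quotient)
  interpret FQ: partial_order "fuzzy_quotient L ?Q" by (rule partial_order_fuzzy_quotient)
  note pull = pullback_fuzzy_up_set[OF X CX]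
  \<comment> \<open>The lower bound is automatic since the bottom is least, so the interval is a
    principal down-set.\<close>
  have carrier_I: "carrier ?I = {A \<in> carrier ?F. A \<sqsubseteq>\<^bsub>?F\<^esub> fuzzy_class L X \<mu>}"
    using bottom_fuzzy_quotient_least[OF X L]
    by (auto simp: interval_order_def at_least_at_most_def least_def)
  have le_I: "le ?I = le ?F" and eq_I: "eq ?I = eq ?F" by (simp_all add: interval_order_def)
  have I: "weak_partial_order ?I"
    by (unfold_locales, unfold le_I eq_I carrier_I)
      (auto simp only: F.eq_is_equal mem_Collect_eq intro: F.le_refl F.le_trans
        dest: F.le_antisym)
  \<comment> \<open>The union over all representatives avoids choosing one; they all contribute the
    same class.\<close>
  define \<Phi> where "\<Phi> A = (\<Union>\<nu>\<in>A. fuzzy_class L X (pullback X C \<nu>))" for A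
  have \<Phi>: "\<Phi> (fuzzy_class L ?Q \<nu>) = fuzzy_class L X (pullback X C \<nu>)"
    if "\<nu> \<in> fuzzy_up_sets L ?Q" for \<nu>
  proof -
    have "fuzzy_class L X (pullback X C \<nu>') = fuzzy_class L X (pullback X C \<nu>)"
      if "\<nu>' \<in> fuzzy_class L ?Q \<nu>" for \<nu>'
      using that pull by (subst fuzzy_class_eq_iff) (auto simp: fuzzy_rel_def cuts_pullback)
    moreover have "\<nu> \<in> fuzzy_class L ?Q \<nu>" using that by (simp add: fuzzy_rel_def)
    ultimately show ?thesis unfolding \<Phi>_def by blast
  qed
  have sub_iff: "cuts L X (pullback X C \<nu>) \<subseteq> cuts L X (pullback X C \<nu>')
      \<longleftrightarrow> cuts L ?Q \<nu> \<subseteq> cuts L ?Q \<nu>'" for \<nu> \<nu>'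
  proof -
    have Pow: "cuts L ?Q \<kappa> \<subseteq> Pow (carrier ?Q)" for \<kappa> by (auto simp: cuts_def cut_def)
    then have "Union T \<in> Union ` cuts L ?Q \<nu>' \<longleftrightarrow> T \<in> cuts L ?Q \<nu>'" if "T \<in> cuts L ?Q \<nu>" for T
      using that by (intro inj_on_image_mem_iff[OF inj_on_Union_classes]) blast+
    then show ?thesis unfolding cuts_pullback image_subset_iff by (simp add: subset_eq)
  qed
  have emb: "\<Phi> A \<sqsubseteq>\<^bsub>?F\<^esub> \<Phi> B \<longleftrightarrow> A \<sqsubseteq>\<^bsub>fuzzy_quotient L ?Q\<^esub> B"
    if "A \<in> carrier (fuzzy_quotient L ?Q)" "B \<in> carrier (fuzzy_quotient L ?Q)" for A B
    using that by (elim fuzzy_classE) (simp add: \<Phi> fuzzy_quotient_le_iff pull sub_iff)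
  have closed: "\<Phi> A \<in> carrier ?F" if "A \<in> carrier (fuzzy_quotient L ?Q)" for A
    using that by (elim fuzzy_classE) (simp add: \<Phi> fuzzy_class_in_quotient pull)
  \<comment> \<open>An order embedding is injective by reflexivity in the target and antisymmetry in
    the source.\<close>
  have "inj_on \<Phi> (carrier (fuzzy_quotient L ?Q))"
  proof (rule inj_onI)
    fix A B assume *: "A \<in> carrier (fuzzy_quotient L ?Q)" "B \<in> carrier (fuzzy_quotient L ?Q)"
      "\<Phi> A = \<Phi> B"
    have "\<Phi> A \<sqsubseteq>\<^bsub>?F\<^esub> \<Phi> B" "\<Phi> B \<sqsubseteq>\<^bsub>?F\<^esub> \<Phi> A"
      unfolding *(3) by (rule F.le_refl[OF closed[OF *(2)]])+
    then show "A = B" unfolding emb[OF *(1,2)] emb[OF *(2,1)] using *(1,2) by (rule FQ.le_antisym)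
  qed
  moreover have "\<Phi> ` carrier (fuzzy_quotient L ?Q) = carrier ?I"
  proof (intro Set.set_eqI iffI)
    fix B assume "B \<in> \<Phi> ` carrier (fuzzy_quotient L ?Q)"
    then obtain \<nu> where \<nu>: "\<nu> \<in> fuzzy_up_sets L ?Q" and B: "B = fuzzy_class L X (pullback X C \<nu>)"
      using \<Phi> by (auto elim!: fuzzy_classE)
    have "cuts L X (pullback X C \<nu>) \<subseteq> cuts L X \<mu>"
      using cuts_subset_up_sets[OF L \<nu>]
      by (auto simp: cuts_\<mu> cuts_pullback saturated_up_sets_def)
    with \<mu> \<nu> show "B \<in> carrier ?I"
      by (simp add: B carrier_I fuzzy_class_in_quotient fuzzy_quotient_le_iff pull)
  next
    fix B assume "B \<in> carrier ?I"
    then obtain \<rho> where \<rho>: "\<rho> \<in> fuzzy_up_sets L X" and B: "B = fuzzy_class L X \<rho>"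
      and "cuts L X \<rho> \<subseteq> saturated_up_sets X C"
      using \<mu> by (auto simp: carrier_I fuzzy_quotient_le_iff cuts_\<mu> elim!: fuzzy_classE)
    then obtain \<nu> where "\<nu> \<in> fuzzy_up_sets L ?Q" "pullback X C \<nu> = \<rho>"
      using pullback_surj[OF X CX L] by blast
    then show "B \<in> \<Phi> ` carrier (fuzzy_quotient L ?Q)"
      using \<Phi> B fuzzy_class_in_quotient by (metis imageI)
  qed
  ultimately show ?thesis
    using emb I FQ.weak_partial_order_axioms
    by (auto simp: order_isomorphic_def order_emb_def bij_betw_def le_I)
qed

text \<open>The first conjunct certifies that the chosen bottom is the element \<open>0\<close>. The
  second ensures that the universal statement about \<open>\<mu>\<close> is not vacuous.\<close>

theorem theorem7:
  fixes X :: "('a, 'm) gorder_scheme" and L :: "('l, 'n) gorder_scheme" and C :: "'a \<Rightarrow> 'a"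
  assumes "partial_order X"
    and "closure_operator X C"
    and "complete_lattice L"
    and "\<exists>C\<^sub>1. closure_operator L C\<^sub>1 \<and>
           order_isomorphic (closure_quotient L C\<^sub>1) (up_set_order X)"
  shows "least (fuzzy_quotient L X) \<bottom>\<^bsub>fuzzy_quotient L X\<^esub> (carrier (fuzzy_quotient L X)) \<and>
    (\<exists>\<mu>\<in>fuzzy_up_sets L X. cuts L X \<mu> = saturated_up_sets X C) \<and>
    (\<forall>\<mu>\<in>fuzzy_up_sets L X. cuts L X \<mu> = saturated_up_sets X C \<longrightarrow>
       order_isomorphic
         (fuzzy_quotient L (closure_quotient X C))
         (interval_order (fuzzy_quotient L X) \<bottom>\<^bsub>fuzzy_quotient L X\<^esub> (fuzzy_class L X \<mu>)))"
  using assms bottom_fuzzy_quotient_least fuzzy_up_set_with_saturated_cuts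
    fuzzy_quotient_closure_quotient_isomorphic
  by blast

end
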